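(* Let $\Gamma$ be a simply-laced Dynkin graph with set of positive roots $\Delta_+$, Weyl group $W$ and coweight lattice $P_\Gamma$. For $\lambda \in P_\Gamma$, there exists a $\lambda$-minuscule element $w \in W$ such that $w(\lambda)$ is dominant if and only if $$\langle \lambda, \alpha^\vee \rangle \geq -1 \quad \text{for all } \alpha \in \Delta_+ .$$
   Context: A simply-laced Dynkin graph is a graph of type $A_n$ ($n\ge 1$), $D_n$ ($n \geq 4$), $E_6$, $E_7$ or $E_8$, with vertex set $I$, simple roots $\alpha_i$ ($i\in I$), root lattice $R_\Gamma=\bigoplus_i \mathbb{Z}\alpha_i$, and Cartan form given by $\langle \alpha_i,\alpha_i\rangle=2$, $\langle\alpha_i,\alpha_j\rangle=-1$ if $i,j$ are adjacent, and $0$ otherwise. The positive roots are $\Delta_+=\{\alpha\in\mathbb{Z}_{\ge 0}^I : \langle\alpha,\alpha\rangle=2\}$, where $\mathbb{Z}^I$ is identified with $R_\Gamma$. $P_\Gamma$ is the lattice of coweights, i.e. the dual $\mathrm{Hom}(R_\Gamma,\mathbb{Z})$ of the root lattice. For $\lambda\in P_\Gamma$ and a root $\alpha$, $\langle\lambda,\alpha^\vee\rangle$ denotes the pairing of $\lambda$ with $\alpha$ (the notation uses the identification of roots and coroots in the simply-laced case). The coroot $\alpha^\vee\in P_\Gamma$ is the element whose pairing with each $\beta\in R_\Gamma$ is $\langle\beta,\alpha\rangle$. The Weyl group $W$ is generated by the simple reflections $s_i$, acting on $P_\Gamma$ by $s_i(\lambda)=\lambda-\langle\lambda,\alpha_i^\vee\rangle\,\alpha_i^\vee$.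 A coweight $\lambda$ is dominant if $\langle\lambda,\alpha_i^\vee\rangle\ge 0$ for all $i\in I$. An element $w\in W$ is $\lambda$-minuscule if there is a reduced expression $w=s_{i_1}s_{i_2}\cdots s_{i_t}$ ($t\ge 0$) such that $s_{i_r}s_{i_{r+1}}\cdots s_{i_t}\lambda=\lambda+\alpha_{i_r}^\vee+\alpha_{i_{r+1}}^\vee+\cdots+\alpha_{i_t}^\vee$ for all $r\in\{1,\dots,t\}$. *)

theory Defs
  imports
    "HOL-Analysis.Finite_Cartesian_Product"
    "HOL-Algebra.Bij"
    "HOL-Algebra.Generated_Groups"
begin

section \<open>Simply-laced Dynkin graphs\<close>

text \<open>
  Standard models with vertices \<open>0, \<dots>, n - 1\<close>. The graph \<open>path_edges n\<close> is the path
  \<open>0 - 1 - \<dots> - (n - 1)\<close>. The graph \<open>branch_edges n k\<close> is the path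
  \<open>0 - 1 - \<dots> - (n - 2)\<close> with one further vertex \<open>n - 1\<close> joined to \<open>k\<close> only; it is
  the diagram \<open>D\<^sub>n\<close> for \<open>k = n - 3\<close> and the diagram \<open>E\<^sub>n\<close> (\<open>n = 6, 7, 8\<close>) for \<open>k = 2\<close>.
\<close>

definition path_edges :: "nat \<Rightarrow> nat rel" where
  "path_edges n = {(a, b). a < n \<and> b < n \<and> (b = Suc a \<or> a = Suc b)}"

definition branch_edges :: "nat \<Rightarrow> nat \<Rightarrow> nat rel" where
  "branch_edges n k = path_edges (n - 1) \<union> {(k, n - 1), (n - 1, k)}"

text \<open>
  A graph is given by its adjacency relation; its vertex set \<open>I\<close> is the whole finite type \<open>'i\<close>.
\<close>

definition graph_iso_to :: "('i \<Rightarrow> 'i \<Rightarrow> bool) \<Rightarrow> nat \<Rightarrow> nat rel \<Rightarrow> bool" where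
  "graph_iso_to adj n R \<longleftrightarrow>
     (\<exists>f. bij_betw f {..<n} UNIV \<and> (\<forall>a<n. \<forall>b<n. adj (f a) (f b) \<longleftrightarrow> (a, b) \<in> R))"

definition simply_laced_dynkin :: "('i \<Rightarrow> 'i \<Rightarrow> bool) \<Rightarrow> bool" where
  "simply_laced_dynkin adj \<longleftrightarrow>
     (\<exists>n\<ge>1. graph_iso_to adj n (path_edges n)) \<or>
     (\<exists>n\<ge>4. graph_iso_to adj n (branch_edges n (n - 3))) \<or>
     (\<exists>n\<in>{6, 7, 8}. graph_iso_to adj n (branch_edges n 2))"


section \<open>Root lattice, Cartan form and positive roots\<close>

text \<open>The root lattice is \<open>int ^ 'i\<close>, the simple roots being the standard basis vectors.\<close>

definition simple_root :: "'i \<Rightarrow> int ^ 'i::finite" where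
  "simple_root i = axis i 1"

definition cartan_entry :: "('i \<Rightarrow> 'i \<Rightarrow> bool) \<Rightarrow> 'i \<Rightarrow> 'i \<Rightarrow> int" where
  "cartan_entry adj i j = (if i = j then 2 else if adj i j then -1 else 0)"

definition cartan_form ::
  "('i \<Rightarrow> 'i \<Rightarrow> bool) \<Rightarrow> int ^ 'i::finite \<Rightarrow> int ^ 'i \<Rightarrow> int" where
  "cartan_form adj x y = (\<Sum>i\<in>UNIV. \<Sum>j\<in>UNIV. x $ i * cartan_entry adj i j * y $ j)"

definition positive_roots :: "('i \<Rightarrow> 'i \<Rightarrow> bool) \<Rightarrow> (int ^ 'i::finite) set" where
  "positive_roots adj = {\<alpha>. (\<forall>i. 0 \<le> \<alpha> $ i) \<and> cartan_form adj \<alpha> \<alpha> = 2}"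


section \<open>Coweights and the Weyl group\<close>

text \<open>
  The coweight lattice is the group of additive maps from the root lattice to the integers, so
  the pairing of a coweight \<open>l\<close> with a root \<open>\<alpha>\<close> is the application \<open>l \<alpha>\<close>.
\<close>

definition coweights :: "(int ^ 'i::finite \<Rightarrow> int) set" where
  "coweights = {l. Modules.additive l}"

definition coroot ::
  "('i \<Rightarrow> 'i \<Rightarrow> bool) \<Rightarrow> int ^ 'i::finite \<Rightarrow> int ^ 'i \<Rightarrow> int" where
  "coroot adj \<alpha> = (\<lambda>\<beta>. cartan_form adj \<beta> \<alpha>)"

definition dominant :: "(int ^ 'i::finite \<Rightarrow> int) \<Rightarrow> bool" where
  "dominant l \<longleftrightarrow> (\<forall>i. 0 \<le> l (simple_root i))"

text \<open>
  The Weyl group is realised as a group of permutations of the coweight lattice, inside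
  \<^term>\<open>BijGroup coweights\<close>; its elements are extensional functions on \<^term>\<open>coweights\<close>.
  Products are compositions, so in a product the rightmost factor acts first.
\<close>

definition simple_reflection ::
  "('i \<Rightarrow> 'i \<Rightarrow> bool) \<Rightarrow> 'i::finite \<Rightarrow> (int ^ 'i \<Rightarrow> int) \<Rightarrow> (int ^ 'i \<Rightarrow> int)" where
  "simple_reflection adj i =
     (\<lambda>l\<in>coweights. \<lambda>\<beta>. l \<beta> - l (simple_root i) * coroot adj (simple_root i) \<beta>)"

definition weyl_group ::
  "('i::finite \<Rightarrow> 'i \<Rightarrow> bool) \<Rightarrow> ((int ^ 'i \<Rightarrow> int) \<Rightarrow> (int ^ 'i \<Rightarrow> int)) set" where
  "weyl_group adj = generate (BijGroup coweights) (range (simple_reflection adj))"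

definition reflection_word ::
  "('i::finite \<Rightarrow> 'i \<Rightarrow> bool) \<Rightarrow> 'i list \<Rightarrow> (int ^ 'i \<Rightarrow> int) \<Rightarrow> (int ^ 'i \<Rightarrow> int)" where
  "reflection_word adj is =
     foldr (\<lambda>i u. simple_reflection adj i \<otimes>\<^bsub>BijGroup coweights\<^esub> u) is \<one>\<^bsub>BijGroup coweights\<^esub>"

definition reduced_expression ::
  "('i::finite \<Rightarrow> 'i \<Rightarrow> bool) \<Rightarrow> 'i list \<Rightarrow> ((int ^ 'i \<Rightarrow> int) \<Rightarrow> (int ^ 'i \<Rightarrow> int)) \<Rightarrow> bool" where
  "reduced_expression adj is w \<longleftrightarrow>
     reflection_word adj is = w \<and>
     (\<forall>js. reflection_word adj js = w \<longrightarrow> length is \<le> length js)"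

text \<open>The suffix of a word starting at its \<open>r\<close>-th letter is \<open>drop r is\<close> with \<open>r\<close> counted from 0.\<close>

definition minuscule ::
  "('i::finite \<Rightarrow> 'i \<Rightarrow> bool) \<Rightarrow> (int ^ 'i \<Rightarrow> int) \<Rightarrow>
    ((int ^ 'i \<Rightarrow> int) \<Rightarrow> (int ^ 'i \<Rightarrow> int)) \<Rightarrow> bool" where
  "minuscule adj l w \<longleftrightarrow>
     w \<in> weyl_group adj \<and>
     (\<exists>is. reduced_expression adj is w \<and>
        (\<forall>r<length is. reflection_word adj (drop r is) l =
           (\<lambda>\<beta>. l \<beta> + (\<Sum>i\<leftarrow>drop r is. coroot adj (simple_root i) \<beta>))))"

end

theory Submission
  imports Defs
begin

text \<open>
  Call a coweight nearly dominant if it is at least \<open>-1\<close> on all positive roots. The reflection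
  \<open>s\<^sub>i\<close> permutes the positive roots other than \<open>\<alpha>\<^sub>i\<close>, so if \<open>\<mu>\<close> takes the value \<open>-1\<close> at \<open>\<alpha>\<^sub>i\<close>, then \<open>\<mu>\<close>
  is nearly dominant iff \<open>s\<^sub>i \<mu> = \<mu> + \<alpha>\<^sub>i\<close> is, and \<open>s\<^sub>i \<mu>\<close> is negative on exactly one positive root less.
  Read from a dominant coweight backwards, this shows that the condition is necessary.
  Conversely, reflecting greedily reaches a dominant coweight after as many steps as
  there are positive roots on which \<open>\<lambda>\<close> is negative. A single simple reflection changes this number by
  at most one, so the resulting word is reduced.
  The Dynkin type enters only through positive definiteness of the Cartan form, obtained by
  completing squares along the arms of the graph towards the branch vertex.
\<close>

section \<open>Positive definiteness of the Cartan form\<close>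

text \<open>The form of a path with vertices \<open>0, \<dots>, m - 1\<close> together with its edge to the next vertex \<open>m\<close>,
  but without the square at \<open>m\<close>.\<close>

definition arm_form :: "nat \<Rightarrow> (nat \<Rightarrow> real) \<Rightarrow> real" where
  "arm_form m X = 2 * (\<Sum>a<m. (X a)\<^sup>2) - 2 * (\<Sum>a<m. X a * X (Suc a))"

text \<open>Squares are completed from the leaf 0 towards \<open>m\<close>. The square started at a
  - 1 uses up a/(a+1) of the coefficient 2 at \<open>a\<close>, which leaves (a+2)/(a+1) for the
  next one.\<close>

lemma arm_form_squares:
  "arm_form m X + real m / (real m + 1) * (X m)\<^sup>2 =
    (\<Sum>a<m. (real a + 2) / (real a + 1) * (X a - (real a + 1) / (real a + 2) * X (Suc a))\<^sup>2)"
proof (induction m)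
  case (Suc m)
  have square: "v / u * (x - u / v * y)\<^sup>2 = v / u * x\<^sup>2 - 2 * (x * y) + u / v * y\<^sup>2"
    if "u \<noteq> 0" "v \<noteq> 0" for u v x y :: real
    using that by (simp add: field_simps power2_eq_square)
  have "arm_form (Suc m) X = arm_form m X + 2 * (X m)\<^sup>2 - 2 * (X m * X (Suc m))"
    by (simp add: arm_form_def)
  moreover have "(real m + 2) / (real m + 1) = 2 - real m / (real m + 1)"
    by (simp add: field_simps)
  hence "(real m + 2) / (real m + 1) * (X m)\<^sup>2 = 2 * (X m)\<^sup>2 - real m / (real m + 1) * (X m)\<^sup>2"
    by (simp only: left_diff_distrib)
  moreover have "real (Suc m) / (real (Suc m) + 1) = (real m + 1) / (real m + 2)"
    by (simp add: add_ac)
  ultimately show ?case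
    using Suc square[of "real m + 1" "real m + 2" "X m" "X (Suc m)"]
    unfolding sum.lessThan_Suc by simp
qed (simp add: arm_form_def)

lemma arm_form_ge: "arm_form m X \<ge> - (real m / (real m + 1) * (X m)\<^sup>2)"
proof -
  have "arm_form m X + real m / (real m + 1) * (X m)\<^sup>2 \<ge> 0"
    unfolding arm_form_squares by (intro sum_nonneg) simp
  thus ?thesis by simp
qed

text \<open>All squares vanish, so each \<open>X a\<close> is a multiple of
  \<open>X (Suc a)\<close>, and the zero at \<open>m\<close> propagates down to the leaf.\<close>

lemma arm_form_nonpos_imp_zero:
  assumes "arm_form m X \<le> 0" "X m = 0" "a \<le> m"
  shows "X a = 0"
proof -
  let ?t = "\<lambda>a. (real a + 2) / (real a + 1) * (X a - (real a + 1) / (real a + 2) * X (Suc a))\<^sup>2"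
  have nn: "?t a \<ge> 0" for a by simp
  have "sum ?t {..<m} \<le> 0" using assms(1,2) arm_form_squares[of m X] by simp
  moreover have "sum ?t {..<m} \<ge> 0" by (intro sum_nonneg nn)
  ultimately have "sum ?t {..<m} = 0" by linarith
  hence z: "?t a = 0" if "a < m" for a
    using that nn by (subst (asm) sum_nonneg_eq_0_iff) auto
  have step: "X a = 0" if "a < m" "X (Suc a) = 0" for a
    using z[OF that(1)] that(2) by (simp add: add_eq_0_iff)
  show ?thesis using assms(3) by (induction rule: inc_induct) (auto simp: step assms(2))
qed

definition path_form :: "nat \<Rightarrow> (nat \<Rightarrow> real) \<Rightarrow> real" where
  "path_form m X = 2 * (\<Sum>a<m. (X a)\<^sup>2) - 2 * (\<Sum>a<m-1. X a * X (Suc a))"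

text \<open>The path is cut at \<open>k\<close>. The right-hand arm is read backwards, so that its
  leaf has index 0 and index \<open>q\<close> is the cut vertex, as in
  \<open>arm_form\<close>.\<close>

lemma path_form_split:
  "path_form (Suc (k + q)) X = arm_form k X + 2 * (X k)\<^sup>2 + arm_form q (\<lambda>j. X (k + q - j))"
proof -
  have s: "(\<Sum>a<k + q. g a) = (\<Sum>a<k. g a) + (\<Sum>j<q. g (k + q - Suc j))" for g :: "nat \<Rightarrow> real"
  proof -
    have "(\<Sum>a<k + q. g a) = (\<Sum>a<k. g a) + (\<Sum>j<q. g (k + j))"
      by (induction q) (simp_all add: add.assoc)
    also have "(\<Sum>j<q. g (k + j)) = (\<Sum>j<q. g (k + (q - Suc j)))"
      by (rule sum.nat_diff_reindex[symmetric])
    also have "\<dots> = (\<Sum>j<q. g (k + q - Suc j))"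
      by (intro sum.cong) simp_all
    finally show ?thesis .
  qed
  have "(\<Sum>a<Suc (k + q). (X a)\<^sup>2) = (X k)\<^sup>2 + (\<Sum>a<k. (X a)\<^sup>2) + (\<Sum>j<q. (X (k + q - j))\<^sup>2)"
  proof -
    have "(\<Sum>a<Suc (k + q). (X a)\<^sup>2) = (\<Sum>a<k. (X a)\<^sup>2) + (\<Sum>j<Suc q. (X (k + j))\<^sup>2)"
      by (induction q) simp_all
    also have "(\<Sum>j<Suc q. (X (k + j))\<^sup>2) = (\<Sum>j<Suc q. (X (k + (Suc q - Suc j)))\<^sup>2)"
      by (rule sum.nat_diff_reindex[symmetric])
    also have "\<dots> = (\<Sum>j<q. (X (k + q - j))\<^sup>2) + (X k)\<^sup>2"
      by simp
    finally show ?thesis by simp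
  qed
  moreover have "(\<Sum>j<q. X (k + q - Suc j) * X (Suc (k + q - Suc j))) =
      (\<Sum>j<q. X (k + q - j) * X (k + q - Suc j))"
    by (intro sum.cong) (simp_all add: Suc_diff_Suc mult.commute)
  ultimately show ?thesis
    using s[of "\<lambda>a. X a * X (Suc a)"] by (simp add: path_form_def arm_form_def)
qed

text \<open>Cut at its last vertex, the path is a single arm, which uses up at most 1 of the
  coefficient 2 there.\<close>

lemma path_form_nonpos_imp_zero:
  assumes "path_form n X \<le> 0" "a < n"
  shows "X a = 0"
proof -
  obtain m where n: "n = Suc m" using assms(2) by (cases n) auto
  have eq: "path_form n X = arm_form m X + 2 * (X m)\<^sup>2"
    using path_form_split[of m 0 X] by (simp add: n arm_form_def)
  have "real m / (real m + 1) * (X m)\<^sup>2 \<le> 1 * (X m)\<^sup>2"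
    by (intro mult_right_mono) simp_all
  with assms(1) eq arm_form_ge[of m X] have "(X m)\<^sup>2 \<le> 0" by linarith
  hence "X m = 0" by simp
  thus ?thesis using arm_form_nonpos_imp_zero[of m X a] assms eq n by simp
qed

text \<open>Arms of k, q and 1 vertices meet at vertex \<open>k\<close> and use up k/(k+1), q/(q+1)
  and 1/2 of the coefficient 2 there. By \<open>coeff\<close> something is left; this is the
  classical condition 1/(k+1) + 1/(q+1) + 1/2 > 1.\<close>

lemma branch_form_nonpos_imp_zero:
  assumes le: "path_form (Suc (k + q)) X + 2 * z\<^sup>2 - 2 * X k * z \<le> 0"
    and coeff: "real k / (real k + 1) + real q / (real q + 1) < 3 / 2"
  shows "z = 0" "a \<le> k + q \<Longrightarrow> X a = 0"
proof -
  let ?Y = "\<lambda>j. X (k + q - j)"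
  have eq: "arm_form k X + arm_form q ?Y + 2 * (X k)\<^sup>2 + 2 * z\<^sup>2 - 2 * X k * z \<le> 0"
    using le by (simp add: path_form_split)
  \<comment> \<open>The pendant vertex is an arm of length 1.\<close>
  have sq: "2 * z\<^sup>2 - 2 * X k * z = 2 * (z - X k / 2)\<^sup>2 - (X k)\<^sup>2 / 2"
    by (simp add: power2_eq_square algebra_simps)
  define A B where "A = real k / (real k + 1)" and "B = real q / (real q + 1)"
  have "arm_form k X \<ge> - (A * (X k)\<^sup>2)" "arm_form q ?Y \<ge> - (B * (X k)\<^sup>2)"
    using arm_form_ge[of k X] arm_form_ge[of q ?Y] by (simp_all add: A_def B_def)
  with eq sq zero_le_power2[of "z - X k / 2"]
  have "(3 / 2 - (A + B)) * (X k)\<^sup>2 \<le> 0"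
    unfolding left_diff_distrib distrib_right by linarith
  hence k: "X k = 0" using coeff by (simp add: A_def B_def mult_le_0_iff)
  have ge: "arm_form k X \<ge> 0" "arm_form q ?Y \<ge> 0"
    using arm_form_ge[of k X] arm_form_ge[of q ?Y] k by simp_all
  have "2 * z\<^sup>2 \<le> 0" using eq ge unfolding k by (simp only: power_zero_numeral mult_zero_left mult_zero_right)
  thus z: "z = 0" by simp
  show "X a = 0" if "a \<le> k + q"
  proof (cases "a \<le> k")
    case True
    thus ?thesis using arm_form_nonpos_imp_zero[of k X a] eq ge k z by simp
  next
    case False
    thus ?thesis using arm_form_nonpos_imp_zero[of q ?Y "k + q - a"] eq ge k z that by simp
  qed
qed

section \<open>Cartan forms of the standard diagrams\<close>

definition graph_form :: "nat \<Rightarrow> nat rel \<Rightarrow> (nat \<Rightarrow> real) \<Rightarrow> real" where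
  "graph_form n R X =
    (\<Sum>a<n. \<Sum>b<n. X a * (if a = b then 2 else if (a, b) \<in> R then -1 else 0) * X b)"

lemma graph_form_Suc:
  assumes "sym R"
  shows "graph_form (Suc n) R X =
    graph_form n R X + 2 * (X n)\<^sup>2 - 2 * (\<Sum>a<n. if (a, n) \<in> R then X a * X n else 0)"
proof -
  have "(\<Sum>a<n. X a * (if a = n then 2 else if (a, n) \<in> R then -1 else 0) * X n)
      = - (\<Sum>a<n. if (a, n) \<in> R then X a * X n else 0)"
    unfolding sum_negf[symmetric] by (intro sum.cong) auto
  moreover have "(\<Sum>a<n. X n * (if n = a then 2 else if (n, a) \<in> R then -1 else 0) * X a)
      = - (\<Sum>a<n. if (a, n) \<in> R then X a * X n else 0)"
    unfolding sum_negf[symmetric] using assms by (intro sum.cong) (auto dest: symD)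
  ultimately show ?thesis
    by (simp add: graph_form_def sum.distrib power2_eq_square)
qed

lemma graph_form_cong:
  assumes "\<And>a b. a < n \<Longrightarrow> b < n \<Longrightarrow> (a, b) \<in> R \<longleftrightarrow> (a, b) \<in> S"
  shows "graph_form n R X = graph_form n S X"
  unfolding graph_form_def using assms by (intro sum.cong) simp_all

lemma sym_path_edges: "sym (path_edges n)"
  by (auto simp: sym_def path_edges_def)

lemma sym_branch_edges: "sym (branch_edges n k)"
  using sym_path_edges[of "n - 1"] by (auto simp: sym_def branch_edges_def)

lemma graph_form_path: "graph_form n (path_edges n) X = path_form n X"
proof (induction n)
  case (Suc n)
  have "graph_form n (path_edges (Suc n)) X = path_form n X"
    unfolding Suc[symmetric] by (rule graph_form_cong) (auto simp: path_edges_def)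
  moreover have "(\<Sum>a<n. if (a, n) \<in> path_edges (Suc n) then X a * X n else 0) =
      (if n = 0 then 0 else X (n - 1) * X n)"
  proof (cases n)
    case (Suc m)
    have "(\<Sum>a<n. if (a, n) \<in> path_edges (Suc n) then X a * X n else 0) =
        (\<Sum>a<n. if a = m then X a * X n else 0)"
      by (intro sum.cong) (auto simp: path_edges_def Suc)
    thus ?thesis by (simp add: Suc)
  qed simp
  ultimately have "graph_form (Suc n) (path_edges (Suc n)) X =
      path_form n X + 2 * (X n)\<^sup>2 - 2 * (if n = 0 then 0 else X (n - 1) * X n)"
    by (simp only: graph_form_Suc[OF sym_path_edges])
  thus ?case by (cases n) (simp_all add: path_form_def)
qed (simp add: graph_form_def path_form_def)

lemma graph_form_branch:
  assumes "k < m"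
  shows "graph_form (Suc m) (branch_edges (Suc m) k) X =
    path_form m X + 2 * (X m)\<^sup>2 - 2 * X k * X m"
proof -
  have "graph_form m (branch_edges (Suc m) k) X = path_form m X"
    unfolding graph_form_path[symmetric] by (rule graph_form_cong) (auto simp: branch_edges_def)
  moreover have "(\<Sum>a<m. if (a, m) \<in> branch_edges (Suc m) k then X a * X m else 0) =
      (\<Sum>a<m. if a = k then X a * X m else 0)"
    using assms by (intro sum.cong) (auto simp: branch_edges_def path_edges_def)
  ultimately show ?thesis
    using assms by (simp add: graph_form_Suc sym_branch_edges)
qed

text \<open>Definiteness is put contrapositively, and over the reals because the completed squares
  have fractional coefficients.\<close>

definition positive_graph :: "nat \<Rightarrow> nat rel \<Rightarrow> bool" where
  "positive_graph n R \<longleftrightarrow> sym R \<and> (\<forall>X. graph_form n R X \<le> 0 \<longrightarrow> (\<forall>a<n. X a = 0))"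

lemma positive_graph_path: "positive_graph n (path_edges n)"
  using path_form_nonpos_imp_zero by (auto simp: positive_graph_def sym_path_edges graph_form_path)

lemma positive_graph_branch:
  assumes n: "n = k + q + 2" and coeff: "real k / (real k + 1) + real q / (real q + 1) < 3 / 2"
  shows "positive_graph n (branch_edges n k)"
  unfolding positive_graph_def
proof (intro conjI allI impI sym_branch_edges)
  fix X a assume X: "graph_form n (branch_edges n k) X \<le> 0" and "a < n"
  have "path_form (Suc (k + q)) X + 2 * (X (Suc (k + q)))\<^sup>2 - 2 * X k * X (Suc (k + q)) \<le> 0"
    using X graph_form_branch[of k "Suc (k + q)" X] by (simp add: n)
  note pos = branch_form_nonpos_imp_zero[OF this coeff]
  show "X a = 0"
    using \<open>a < n\<close> pos(1) pos(2)[of a] n by (cases "a = Suc (k + q)") auto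
qed

lemma simply_laced_dynkin_positive_graph:
  assumes "simply_laced_dynkin adj"
  obtains n R where "graph_iso_to adj n R" "positive_graph n R"
proof -
  consider (A) n where "graph_iso_to adj n (path_edges n)"
    | (D) n where "n \<ge> 4" "graph_iso_to adj n (branch_edges n (n - 3))"
    | (E) n where "n \<in> {6, 7, 8}" "graph_iso_to adj n (branch_edges n 2)"
    using assms by (auto simp: simply_laced_dynkin_def)
  thus thesis
  proof cases
    case A thus ?thesis using that positive_graph_path by blast
  next
    case D
    \<comment> \<open>The arms have n - 3, 1 and 1 vertices, and (n-3)/(n-2) + 1/2 < 3/2.\<close>
    have "positive_graph n (branch_edges n (n - 3))"
      by (rule positive_graph_branch[where q = 1]) (use D in \<open>simp_all add: field_simps\<close>)
    thus ?thesis using that D by blast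
  next
    case E
    \<comment> \<open>The arms have 2, n - 4 and 1 vertices; 2/3 + (n-4)/(n-3) < 3/2 amounts to n <
      9, which is where the E series stops.\<close>
    have "positive_graph n (branch_edges n 2)"
      by (rule positive_graph_branch[where q = "n - 4"]) (use E in auto)
    thus ?thesis using that E by blast
  qed
qed

text \<open>The numbering of the vertices turns an integer vector into a real function with the same
  value of the form.\<close>

lemma positive_graph_cartan_form:
  fixes adj :: "'i::finite \<Rightarrow> 'i \<Rightarrow> bool"
  assumes iso: "graph_iso_to adj n R" and pos: "positive_graph n R"
  shows "adj i j \<Longrightarrow> adj j i" and "x \<noteq> 0 \<Longrightarrow> cartan_form adj x x > 0"
proof -
  obtain f where f: "bij_betw f {..<n} UNIV"
    and adj: "\<And>a b. a < n \<Longrightarrow> b < n \<Longrightarrow> adj (f a) (f b) \<longleftrightarrow> (a, b) \<in> R"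
    using iso by (auto simp: graph_iso_to_def)
  have surj: "\<exists>a<n. f a = i" for i
    using bij_betw_imp_surj_on[OF f] by (metis UNIV_I imageE lessThan_iff)
  show "adj j i" if "adj i j"
    using that pos surj[of i] surj[of j] adj by (auto simp: positive_graph_def dest: symD)
  have reindex: "(\<Sum>i\<in>UNIV. g i) = (\<Sum>a<n. g (f a))" for g :: "'i \<Rightarrow> int"
    by (rule sum.reindex_bij_betw[OF f, symmetric])
  have "cartan_entry adj (f a) (f b) = (if a = b then 2 else if (a, b) \<in> R then -1 else 0)"
    if "a < n" "b < n" for a b
    using that adj bij_betw_imp_inj_on[OF f] by (auto simp: cartan_entry_def inj_on_def)
  hence "cartan_form adj x x =
      (\<Sum>a<n. \<Sum>b<n. x $ f a * (if a = b then 2 else if (a, b) \<in> R then -1 else 0) * x $ f b)"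
    unfolding cartan_form_def reindex by (intro sum.cong) simp_all
  hence form: "real_of_int (cartan_form adj x x) = graph_form n R (\<lambda>a. real_of_int (x $ f a))"
    unfolding graph_form_def by simp (intro sum.cong, simp_all)
  show "cartan_form adj x x > 0" if "x \<noteq> 0"
  proof (rule ccontr)
    assume "\<not> cartan_form adj x x > 0"
    hence "graph_form n R (\<lambda>a. real_of_int (x $ f a)) \<le> 0" unfolding form[symmetric] by simp
    hence "\<forall>a<n. real_of_int (x $ f a) = 0" using pos unfolding positive_graph_def by blast
    hence "\<forall>a<n. x $ f a = 0" by simp
    hence "x = 0" using surj by (metis vec_eq_iff zero_index)
    with that show False by simp
  qed
qed

section \<open>Reflections of coweights\<close>

lemma additive_axis:
  fixes l :: "int ^ 'i::finite \<Rightarrow> int"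
  assumes "Modules.additive l"
  shows "l (axis i k) = k * l (axis i 1)"
proof -
  interpret additive l by (fact assms)
  have split: "axis i (a + b) = axis i a + axis i b" for a b :: int
    by (simp add: vec_eq_iff axis_def)
  have "axis i (0::int) = 0" by (simp add: vec_eq_iff axis_def)
  hence "l (axis i 0) = 0" by (simp only: zero)
  hence n: "l (axis i (int n)) = int n * l (axis i 1)" for n
    by (induction n) (simp_all add: split add algebra_simps)
  have "axis i (- a) = - axis i a" for a :: int
    by (simp add: vec_eq_iff axis_def)
  thus ?thesis
    by (cases k rule: int_cases2) (simp_all add: n minus)
qed

lemma cartan_form_add_left:
  "cartan_form adj (x + y) z = cartan_form adj x z + cartan_form adj y z"
  by (simp add: cartan_form_def sum.distrib algebra_simps)

lemma cartan_form_diff_left: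
  "cartan_form adj (x - y) z = cartan_form adj x z - cartan_form adj y z"
  by (simp add: cartan_form_def sum_subtractf algebra_simps)

lemma cartan_form_add_right:
  "cartan_form adj z (x + y) = cartan_form adj z x + cartan_form adj z y"
  by (simp add: cartan_form_def sum.distrib algebra_simps)

lemma cartan_form_diff_right:
  "cartan_form adj z (x - y) = cartan_form adj z x - cartan_form adj z y"
  by (simp add: cartan_form_def sum_subtractf algebra_simps)

lemmas cartan_form_bilinear =
  cartan_form_add_left cartan_form_diff_left cartan_form_add_right cartan_form_diff_right

lemma cartan_form_scale:
  "cartan_form adj (c *s x) (c *s x) = c\<^sup>2 * cartan_form adj x x"
  by (simp add: cartan_form_def sum_distrib_left power2_eq_square algebra_simps)

lemma cartan_form_axis_right:
  "cartan_form adj x (axis i k) = k * cartan_form adj x (simple_root i)"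
  unfolding simple_root_def
  by (rule additive_axis[of "cartan_form adj x"])
     (simp add: Modules.additive_def cartan_form_add_right)

lemma cartan_form_simple_root:
  "cartan_form adj x (simple_root i) = (\<Sum>j\<in>UNIV. x $ j * cartan_entry adj j i)"
  by (simp add: cartan_form_def simple_root_def axis_def if_distrib cong: if_cong)

lemma cartan_form_simple_root_self [simp]:
  "cartan_form adj (simple_root i) (simple_root i) = 2"
proof -
  have "simple_root i $ j * cartan_entry adj j i = (if j = i then 2 else 0)" for j
    by (simp add: simple_root_def axis_def cartan_entry_def)
  thus ?thesis by (simp add: cartan_form_simple_root)
qed

lemma coweight_axis:
  "l \<in> coweights \<Longrightarrow> l (axis i k) = k * l (simple_root i)"
  by (simp add: coweights_def simple_root_def additive_axis[of l i k])

lemma coweight_diff: "l \<in> coweights \<Longrightarrow> l (x - y) = l x - l y"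
  by (simp add: coweights_def additive.diff)

section \<open>Simple reflections and words acting on coweights\<close>

lemma simple_reflection_apply:
  "l \<in> coweights \<Longrightarrow>
   simple_reflection adj i l = (\<lambda>\<beta>. l \<beta> - l (simple_root i) * cartan_form adj \<beta> (simple_root i))"
  by (simp add: simple_reflection_def coroot_def)

lemma simple_reflection_coweights:
  "l \<in> coweights \<Longrightarrow> simple_reflection adj i l \<in> coweights"
  by (simp add: simple_reflection_apply)
     (simp add: coweights_def Modules.additive_def cartan_form_add_left algebra_simps)

lemma simple_reflection_involution:
  assumes "l \<in> coweights"
  shows "simple_reflection adj i (simple_reflection adj i l) = l"
  by (simp add: assms simple_reflection_apply[OF simple_reflection_coweights[OF assms]])
     (simp add: assms simple_reflection_apply algebra_simps)

lemma simple_reflection_Bij: "simple_reflection adj i \<in> carrier (BijGroup coweights)"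
proof -
  have "bij_betw (simple_reflection adj i) coweights coweights"
    by (rule bij_betw_byWitness[where f' = "simple_reflection adj i"])
       (auto simp: simple_reflection_involution simple_reflection_coweights)
  thus ?thesis
    by (simp add: BijGroup_def Bij_def simple_reflection_def)
qed

lemma reflection_word_weyl: "reflection_word adj is \<in> weyl_group adj"
  unfolding reflection_word_def weyl_group_def
  by (induction "is") (auto intro: generate.intros)

lemma reflection_word_Bij: "reflection_word adj is \<in> carrier (BijGroup coweights)"
proof -
  interpret group "BijGroup coweights" by (rule group_BijGroup)
  show ?thesis
    unfolding reflection_word_def by (induction "is") (simp_all add: simple_reflection_Bij)
qed

lemma reflection_word_Nil [simp]: "l \<in> coweights \<Longrightarrow> reflection_word adj [] l = l"
  by (simp add: reflection_word_def BijGroup_def)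

lemma reflection_word_Cons:
  "l \<in> coweights \<Longrightarrow>
   reflection_word adj (i # is) l = simple_reflection adj i (reflection_word adj is l)"
  using simple_reflection_Bij[of adj i] reflection_word_Bij[of adj "is"]
  by (simp add: reflection_word_def BijGroup_def compose_def)

lemma reflection_word_coweights:
  "l \<in> coweights \<Longrightarrow> reflection_word adj is l \<in> coweights"
  by (induction "is") (simp_all add: reflection_word_Cons simple_reflection_coweights)

text \<open>The coroot condition of \<open>minuscule\<close>, separated from reducedness: it can be
  followed letter by letter, whereas reducedness comes from counting roots.\<close>

definition adds_simple_coroots ::
  "('i::finite \<Rightarrow> 'i \<Rightarrow> bool) \<Rightarrow> 'i list \<Rightarrow> (int ^ 'i \<Rightarrow> int) \<Rightarrow> bool" where
  "adds_simple_coroots adj is l \<longleftrightarrow>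
     (\<forall>r<length is. reflection_word adj (drop r is) l =
        (\<lambda>\<beta>. l \<beta> + (\<Sum>i\<leftarrow>drop r is. coroot adj (simple_root i) \<beta>)))"

lemma adds_simple_coroots_Nil [simp]: "adds_simple_coroots adj [] l"
  by (simp add: adds_simple_coroots_def)

text \<open>Among the suffixes only the whole word is new, and there the reflection adds exactly one
  coroot iff the coefficient it subtracts is -1.\<close>

lemma adds_simple_coroots_Cons:
  assumes l: "l \<in> coweights"
  shows "adds_simple_coroots adj (i # is) l \<longleftrightarrow>
     adds_simple_coroots adj is l \<and> reflection_word adj is l (simple_root i) = -1"
proof -
  let ?w = "reflection_word adj is l" and ?c = "coroot adj (simple_root i)"
  let ?sum = "\<lambda>\<beta>. \<Sum>i\<leftarrow>is. coroot adj (simple_root i) \<beta>"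
  have iff: "adds_simple_coroots adj (i # is) l \<longleftrightarrow>
      reflection_word adj (i # is) l = (\<lambda>\<beta>. l \<beta> + (?c \<beta> + ?sum \<beta>)) \<and> adds_simple_coroots adj is l"
    unfolding adds_simple_coroots_def length_Cons All_less_Suc2 drop_0 drop_Suc_Cons
    by (simp only: list.map sum_list.Cons)
  have reflect: "reflection_word adj (i # is) l = (\<lambda>\<beta>. ?w \<beta> - ?w (simple_root i) * ?c \<beta>)"
    by (simp only: reflection_word_Cons[OF l]
        simple_reflection_apply[OF reflection_word_coweights[OF l]] coroot_def)
  \<comment> \<open>For a nonempty word this is the case r = 0; the empty word has no such r but
    acts as the identity.\<close>
  have w: "?w = (\<lambda>\<beta>. l \<beta> + ?sum \<beta>)" if "adds_simple_coroots adj is l"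
  proof (cases "is")
    case Nil thus ?thesis by (simp add: l)
  next
    case Cons thus ?thesis using that by (force simp: adds_simple_coroots_def)
  qed
  \<comment> \<open>The scalar is recovered by evaluating at the simple root, where
    \<open>?c\<close> is 2.\<close>
  have "(\<lambda>\<beta>. ?w \<beta> - ?w (simple_root i) * ?c \<beta>) = (\<lambda>\<beta>. ?w \<beta> + ?c \<beta>) \<longleftrightarrow>
      ?w (simple_root i) = -1"
    by (auto simp: fun_eq_iff coroot_def dest: spec[of _ "simple_root i"])
  moreover have "(\<lambda>\<beta>. ?w \<beta> + ?c \<beta>) = (\<lambda>\<beta>. l \<beta> + (?c \<beta> + ?sum \<beta>))"
    if "adds_simple_coroots adj is l"
    by (simp add: w[OF that] add_ac)
  ultimately show ?thesis
    unfolding iff reflect by (cases "adds_simple_coroots adj is l") (simp_all only: simp_thms)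
qed

section \<open>Positive roots and nearly dominant coweights\<close>

text \<open>This is all that is taken from the Dynkin type from here on.\<close>

locale positive_cartan_form =
  fixes adj :: "'i::finite \<Rightarrow> 'i \<Rightarrow> bool"
  assumes adj_sym: "adj i j \<Longrightarrow> adj j i"
    and cartan_form_pos: "x \<noteq> 0 \<Longrightarrow> cartan_form adj x x > 0"
begin

lemma cartan_form_nonneg: "cartan_form adj x x \<ge> 0"
  using cartan_form_pos[of x] by (cases "x = 0") (auto simp: cartan_form_def)

lemma cartan_form_sym: "cartan_form adj x y = cartan_form adj y x"
proof -
  have "cartan_entry adj i j = cartan_entry adj j i" for i j
    using adj_sym by (auto simp: cartan_entry_def)
  thus ?thesis
    unfolding cartan_form_def by (subst sum.swap) (simp add: mult.commute mult.left_commute)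
qed

text \<open>Roots congruent modulo 3 coincide: the difference of two roots has norm at most 8, and a
  nonzero multiple of 3 has norm at least 9.\<close>

lemma finite_positive_roots: "finite (positive_roots adj)"
proof -
  let ?m = "\<lambda>\<beta>::int^'i. \<lambda>i. \<beta> $ i mod 3"
  have "inj_on ?m (positive_roots adj)"
  proof (rule inj_onI, rule ccontr)
    fix x y assume x: "x \<in> positive_roots adj" and y: "y \<in> positive_roots adj"
      and eq: "?m x = ?m y" and "x \<noteq> y"
    define d :: "int^'i" where "d = (\<chi> i. (x $ i - y $ i) div 3)"
    have "3 dvd x $ i - y $ i" for i
      using fun_cong[OF eq, of i] by (simp add: mod_eq_dvd_iff)
    hence d: "x - y = 3 *s d" by (simp add: vec_eq_iff d_def)
    with \<open>x \<noteq> y\<close> have "d \<noteq> 0" by auto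
    from cartan_form_pos[OF this] have "cartan_form adj (x - y) (x - y) \<ge> 9"
      by (simp add: d cartan_form_scale)
    \<comment> \<open>By the parallelogram law the norms of x + y and x - y add up to 8.\<close>
    with cartan_form_nonneg[of "x + y"] x y show False
      by (simp add: positive_roots_def cartan_form_bilinear cartan_form_sym[of y x])
  qed
  moreover have "?m ` positive_roots adj \<subseteq> (UNIV :: 'i set) \<rightarrow>\<^sub>E {0..<3}"
    by auto
  hence "finite (?m ` positive_roots adj)"
    by (rule finite_subset) (simp add: finite_PiE)
  ultimately show ?thesis using finite_imageD by blast
qed

lemma cartan_form_axis_left:
  "cartan_form adj (axis i k) x = k * cartan_form adj x (simple_root i)"
  by (rule trans[OF cartan_form_sym cartan_form_axis_right])

section \<open>Reflections acting on roots\<close>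

definition root_reflection :: "'i \<Rightarrow> int ^ 'i \<Rightarrow> int ^ 'i" where
  "root_reflection i \<beta> = \<beta> - axis i (cartan_form adj \<beta> (simple_root i))"

lemma root_reflection_involution: "root_reflection i (root_reflection i \<beta>) = \<beta>"
proof -
  have "cartan_form adj (root_reflection i \<beta>) (simple_root i) = - cartan_form adj \<beta> (simple_root i)"
    by (simp add: root_reflection_def cartan_form_diff_left
        cartan_form_axis_left)
  thus ?thesis by (simp add: root_reflection_def vec_eq_iff axis_def)
qed

lemma root_reflection_isometry:
  "cartan_form adj (root_reflection i \<beta>) (root_reflection i \<beta>) = cartan_form adj \<beta> \<beta>"
proof -
  define k where "k = cartan_form adj \<beta> (simple_root i)"
  have "cartan_form adj (axis i k) (axis i k) = k * (k * 2)"
    unfolding cartan_form_axis_right[of adj "axis i k" i k] cartan_form_axis_left by simp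
  thus ?thesis
    unfolding root_reflection_def k_def[symmetric] cartan_form_diff_left cartan_form_diff_right
    by (simp add: cartan_form_axis_left cartan_form_axis_right[of adj \<beta>] k_def[symmetric])
qed

text \<open>Only the i-th coordinate changes, to \<open>c\<close>. The rest \<open>x\<close> of the
  root is nonzero, so it has norm at least 1, and it pairs nonpositively with the simple root. A
  negative \<open>c\<close> would thus give norm at least 1 + 0 + 2 > 2, although reflections
  preserve the norm 2.\<close>

lemma root_reflection_positive:
  assumes \<beta>: "\<beta> \<in> positive_roots adj" and ne: "\<beta> \<noteq> simple_root i"
  shows "root_reflection i \<beta> \<in> positive_roots adj"
proof -
  define x where "x = \<beta> - axis i (\<beta> $ i)"
  define c where "c = root_reflection i \<beta> $ i"
  have nonneg: "\<beta> $ j \<ge> 0" for j using \<beta> by (simp add: positive_roots_def)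
  have norm: "cartan_form adj \<beta> \<beta> = 2" using \<beta> by (simp add: positive_roots_def)
  have x_j: "x $ j = (if j = i then 0 else \<beta> $ j)" for j by (simp add: x_def axis_def)
  have refl: "root_reflection i \<beta> = x + axis i c"
    by (simp add: c_def x_def root_reflection_def vec_eq_iff axis_def)
  have "x \<noteq> 0"
  proof
    assume "x = 0"
    hence b: "\<beta> = axis i (\<beta> $ i)" by (simp add: x_def)
    have "cartan_form adj (axis i (\<beta> $ i)) (axis i (\<beta> $ i)) = (\<beta> $ i)\<^sup>2 * 2"
      by (simp add: cartan_form_axis_left cartan_form_axis_right power2_eq_square)
    with norm have "(\<beta> $ i)\<^sup>2 = 1" by (simp add: b[symmetric])
    with nonneg[of i] have "\<beta> $ i = 1" by (simp add: power2_eq_1_iff)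
    with b ne show False by (metis simple_root_def)
  qed
  hence x_pos: "cartan_form adj x x \<ge> 1" using cartan_form_pos[of x] by simp
  \<comment> \<open>The i-th coordinate of \<open>x\<close> is 0, and off-diagonal Cartan entries
    are at most 0.\<close>
  have x_i: "cartan_form adj x (simple_root i) \<le> 0"
    unfolding cartan_form_simple_root
    by (rule sum_nonpos) (simp add: x_j cartan_entry_def nonneg)
  have "c \<ge> 0"
  proof (rule ccontr)
    assume "\<not> c \<ge> 0"
    have "cartan_form adj (root_reflection i \<beta>) (root_reflection i \<beta>) =
        cartan_form adj x x + 2 * (c * cartan_form adj x (simple_root i)) + 2 * (c * c)"
      by (simp add: refl cartan_form_bilinear cartan_form_axis_right
          cartan_form_axis_left algebra_simps)
    moreover have "c * cartan_form adj x (simple_root i) \<ge> 0"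
      using \<open>\<not> c \<ge> 0\<close> x_i by (simp add: mult_nonpos_nonpos)
    moreover have "c * c > 0" using \<open>\<not> c \<ge> 0\<close> by (simp add: mult_neg_neg)
    ultimately show False using x_pos norm by (simp add: root_reflection_isometry)
  qed
  hence "root_reflection i \<beta> $ j \<ge> 0" for j by (simp add: refl axis_def x_j nonneg)
  thus ?thesis using norm by (simp add: positive_roots_def root_reflection_isometry)
qed

lemma simple_root_positive: "simple_root i \<in> positive_roots adj"
  by (simp add: positive_roots_def) (simp add: simple_root_def axis_def)

lemma root_reflection_simple_root [simp]: "root_reflection i (simple_root i) = - simple_root i"
  by (simp add: root_reflection_def) (simp add: simple_root_def vec_eq_iff axis_def)

lemma root_reflection_positive_ne:
  assumes "\<beta> \<in> positive_roots adj"
  shows "root_reflection i \<beta> \<noteq> simple_root i"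
proof
  assume "root_reflection i \<beta> = simple_root i"
  hence "\<beta> = - simple_root i"
    by (metis root_reflection_involution root_reflection_simple_root)
  hence "\<beta> $ i = -1" by (simp add: simple_root_def axis_def)
  with assms show False by (auto simp: positive_roots_def dest: spec[of _ i])
qed

text \<open>Moving the reflection from the coweight to the root makes values of a reflected coweight
  readable from the permutation of the positive roots.\<close>

lemma simple_reflection_eval:
  "l \<in> coweights \<Longrightarrow> simple_reflection adj i l \<beta> = l (root_reflection i \<beta>)"
  by (simp add: simple_reflection_apply root_reflection_def coweight_diff coweight_axis)

lemma simple_reflection_simple_root:
  "l \<in> coweights \<Longrightarrow> simple_reflection adj i l (simple_root i) = - l (simple_root i)"
  by (simp add: simple_reflection_apply)

section \<open>Near dominance under reflection\<close>

definition nearly_dominant :: "(int ^ 'i \<Rightarrow> int) \<Rightarrow> bool" where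
  "nearly_dominant l \<longleftrightarrow> (\<forall>\<beta>\<in>positive_roots adj. l \<beta> \<ge> -1)"

text \<open>The value at the simple root changes sign, so its upper bound 1 becomes the lower bound
  -1; the values at other positive roots are old values at positive roots.\<close>

lemma nearly_dominant_reflect:
  assumes l: "l \<in> coweights" and "nearly_dominant l" and "l (simple_root i) \<le> 1"
  shows "nearly_dominant (simple_reflection adj i l)"
  unfolding nearly_dominant_def
proof
  fix \<beta> assume \<beta>: "\<beta> \<in> positive_roots adj"
  show "simple_reflection adj i l \<beta> \<ge> -1"
  proof (cases "\<beta> = simple_root i")
    case True thus ?thesis using assms by (simp add: simple_reflection_simple_root)
  next
    case False
    with root_reflection_positive[OF \<beta>] show ?thesis
      using assms by (simp add: nearly_dominant_def simple_reflection_eval)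
  qed
qed

text \<open>The previous lemma is applied to the reflected coweight, whose value at the simple root
  is at most 1.\<close>

lemma nearly_dominant_unreflect:
  assumes l: "l \<in> coweights" and "nearly_dominant (simple_reflection adj i l)"
    and "l (simple_root i) \<ge> -1"
  shows "nearly_dominant l"
  using nearly_dominant_reflect[OF simple_reflection_coweights[OF l] assms(2), of i] assms(3)
  by (simp add: simple_reflection_involution simple_reflection_simple_root l)

lemma dominant_nonneg:
  assumes l: "l \<in> coweights" and dom: "dominant l" and \<beta>: "\<beta> \<in> positive_roots adj"
  shows "l \<beta> \<ge> 0"
proof -
  interpret additive l using l by (simp add: coweights_def)
  have "\<beta> = (\<Sum>i\<in>UNIV. axis i (\<beta> $ i))"
    by (simp add: vec_eq_iff axis_def sum_component)
  hence "l \<beta> = (\<Sum>i\<in>UNIV. l (axis i (\<beta> $ i)))"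
    using sum[of "\<lambda>i. axis i (\<beta> $ i)" UNIV] by (simp only:)
  also have "\<dots> \<ge> 0"
    using \<beta> dom by (intro sum_nonneg) (simp add: coweight_axis l positive_roots_def dominant_def)
  finally show ?thesis .
qed

lemma dominant_imp_nearly_dominant:
  "l \<in> coweights \<Longrightarrow> dominant l \<Longrightarrow> nearly_dominant l"
  using dominant_nonneg by (force simp: nearly_dominant_def)

section \<open>Counting the positive roots with negative value\<close>

definition negative_set :: "(int ^ 'i \<Rightarrow> int) \<Rightarrow> (int ^ 'i) set" where
  "negative_set l = {\<beta> \<in> positive_roots adj. l \<beta> < 0}"

lemma finite_negative_set: "finite (negative_set l)"
  using finite_positive_roots by (simp add: negative_set_def)

lemma negative_set_reflect_subset:
  assumes "l \<in> coweights"
  shows "root_reflection i ` (negative_set l - {simple_root i})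
    \<subseteq> negative_set (simple_reflection adj i l) - {simple_root i}"
  using assms root_reflection_positive root_reflection_positive_ne
  by (auto simp: negative_set_def simple_reflection_eval root_reflection_involution)

text \<open>Applied to the reflected coweight as well, this shows that the two counts agree away
  from the simple root.\<close>

lemma card_negative_set_reflect:
  assumes "l \<in> coweights"
  shows "card (negative_set l - {simple_root i})
    \<le> card (negative_set (simple_reflection adj i l) - {simple_root i})"
proof (rule card_inj_on_le[OF _ negative_set_reflect_subset[OF assms]])
  show "inj_on (root_reflection i) (negative_set l - {simple_root i})"
    by (metis inj_onI root_reflection_involution)
qed (simp add: finite_negative_set)

lemma card_negative_set_le:
  assumes "l \<in> coweights"
  shows "card (negative_set l) \<le> Suc (card (negative_set (simple_reflection adj i l)))"
proof -
  have "card (negative_set l) \<le> Suc (card (negative_set l - {simple_root i}))"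
    by (metis card_Diff1_le card_Suc_Diff1 finite_negative_set Diff_empty Diff_insert0 le_SucI
        order_refl)
  also have "\<dots> \<le> Suc (card (negative_set (simple_reflection adj i l) - {simple_root i}))"
    using card_negative_set_reflect[OF assms] by simp
  also have "\<dots> \<le> Suc (card (negative_set (simple_reflection adj i l)))"
    by (simp add: card_Diff1_le)
  finally show ?thesis .
qed

lemma card_negative_set_Suc:
  assumes l: "l \<in> coweights" and neg: "l (simple_root i) < 0"
  shows "card (negative_set l) = Suc (card (negative_set (simple_reflection adj i l)))"
proof (rule antisym[OF card_negative_set_le[OF l]])
  let ?m = "simple_reflection adj i l"
  have "simple_root i \<in> negative_set l" "simple_root i \<notin> negative_set ?m"
    using neg by (simp_all add: negative_set_def simple_root_positive simple_reflection_simple_root l)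
  \<comment> \<open>The inequality is used for \<open>?m\<close>, whose reflection is
    \<open>l\<close>; deleting the simple root from \<open>negative_set ?m\<close> changes
    nothing.\<close>
  moreover from this have "card (negative_set ?m) \<le> card (negative_set l - {simple_root i})"
    using card_negative_set_reflect[OF simple_reflection_coweights[OF l, of adj i], of i]
    by (simp add: simple_reflection_involution[OF l])
  ultimately show "Suc (card (negative_set ?m)) \<le> card (negative_set l)"
    using card_Suc_Diff1[OF finite_negative_set, of "simple_root i" l] by simp
qed

text \<open>Each letter lowers the count by at most one. If the word ends at a dominant coweight,
  this bounds its length from below.\<close>

lemma card_negative_set_word:
  assumes "l \<in> coweights"
  shows "card (negative_set l) \<le> length is + card (negative_set (reflection_word adj is l))"
proof (induction "is")
  case (Cons i "is")
  thus ?case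
    using card_negative_set_le[OF reflection_word_coweights[OF assms], of adj "is" i]
    by (simp add: reflection_word_Cons assms)
qed (simp add: assms)

lemma negative_set_dominant: "l \<in> coweights \<Longrightarrow> dominant l \<Longrightarrow> negative_set l = {}"
  using dominant_nonneg by (force simp: negative_set_def)

text \<open>Greedy construction, by induction on the number of negative roots still left. The last
  assumption is the invariant that every letter so far has removed one of them. Letters are
  prepended because the rightmost one acts first.\<close>

lemma nearly_dominant_extend:
  assumes l: "l \<in> coweights"
    and "adds_simple_coroots adj is l" "nearly_dominant (reflection_word adj is l)"
    and "length is + card (negative_set (reflection_word adj is l)) = card (negative_set l)"
  shows "\<exists>js. adds_simple_coroots adj js l \<and> dominant (reflection_word adj js l) \<and>
    length js \<le> card (negative_set l)"
  using assms(2-)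
proof (induction "card (negative_set (reflection_word adj is l))" arbitrary: "is" rule: less_induct)
  case less
  let ?m = "reflection_word adj is l"
  have m: "?m \<in> coweights" by (simp add: reflection_word_coweights l)
  show ?case
  proof (cases "dominant ?m")
    case True
    thus ?thesis using less.prems by (intro exI[of _ "is"]) simp
  next
    case False
    then obtain i where "?m (simple_root i) < 0" by (auto simp: dominant_def not_le)
    moreover from less.prems(2) have "?m (simple_root i) \<ge> -1"
      by (simp add: nearly_dominant_def simple_root_positive)
    ultimately have i: "?m (simple_root i) = -1" by simp
    show ?thesis
      using less.prems i card_negative_set_Suc[OF m, of i] nearly_dominant_reflect[OF m, of i]
      by (intro less.hyps[of "i # is"])
         (simp_all add: reflection_word_Cons adds_simple_coroots_Cons l)
  qed
qed

lemma minuscule_exists: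
  assumes l: "l \<in> coweights" and "nearly_dominant l"
  shows "\<exists>w\<in>weyl_group adj. minuscule adj l w \<and> dominant (w l)"
proof -
  obtain js where js: "adds_simple_coroots adj js l" "dominant (reflection_word adj js l)"
      "length js \<le> card (negative_set l)"
    using nearly_dominant_extend[of l "[]"] assms by auto
  \<comment> \<open>A word for the same group element also leads to a dominant coweight, so it has
    at least \<open>card (negative_set l)\<close> letters.\<close>
  have "length js \<le> length is" if "reflection_word adj is = reflection_word adj js" for "is"
    using card_negative_set_word[OF l, of "is"] js(3) that
      negative_set_dominant[OF reflection_word_coweights[OF l] js(2)] by simp
  hence "reduced_expression adj js (reflection_word adj js)"
    by (simp add: reduced_expression_def)
  with js show ?thesis
    unfolding minuscule_def adds_simple_coroots_def using reflection_word_weyl by blast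
qed

text \<open>The word is undone from its first letter on; each letter acted at value -1, so near
  dominance can be pulled back through it.\<close>

lemma adds_simple_coroots_nearly_dominant:
  assumes l: "l \<in> coweights"
    and "adds_simple_coroots adj is l" "nearly_dominant (reflection_word adj is l)"
  shows "nearly_dominant l"
  using assms(2-)
proof (induction "is")
  case (Cons i "is")
  thus ?case
    using nearly_dominant_unreflect[OF reflection_word_coweights[OF l, of adj "is"], of i]
    by (simp add: adds_simple_coroots_Cons reflection_word_Cons l)
qed (simp add: l)

theorem minuscule_dominant_iff:
  assumes l: "l \<in> coweights"
  shows "(\<exists>w\<in>weyl_group adj. minuscule adj l w \<and> dominant (w l)) \<longleftrightarrow> nearly_dominant l"
proof
  assume "\<exists>w\<in>weyl_group adj. minuscule adj l w \<and> dominant (w l)"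
  then obtain "is" where "adds_simple_coroots adj is l" "dominant (reflection_word adj is l)"
    by (auto simp: minuscule_def reduced_expression_def adds_simple_coroots_def)
  thus "nearly_dominant l"
    using adds_simple_coroots_nearly_dominant dominant_imp_nearly_dominant
      reflection_word_coweights l by metis
qed (rule minuscule_exists[OF l])

end

theorem theorem1p1:
  fixes adj :: "'i::finite \<Rightarrow> 'i \<Rightarrow> bool"
    and l :: "int ^ 'i \<Rightarrow> int"
  assumes "simply_laced_dynkin adj"
    and "l \<in> coweights"
  shows "(\<exists>w\<in>weyl_group adj. minuscule adj l w \<and> dominant (w l)) \<longleftrightarrow>
         (\<forall>\<alpha>\<in>positive_roots adj. l \<alpha> \<ge> -1)"
proof -
  obtain n R where "graph_iso_to adj n R" "positive_graph n R"
    using simply_laced_dynkin_positive_graph[OF assms(1)] .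
  then interpret positive_cartan_form adj
    by unfold_locales (fact positive_graph_cartan_form)+
  show ?thesis
    using minuscule_dominant_iff[OF assms(2)] by (simp only: nearly_dominant_def)
qed

end
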